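(* Let $\mathcal{L}$ be a nonempty subclass of $\mathcal{M}$ and let $M,Q$ be $R$-modules. Consider the following conditions: (1) $Q$ is $s$-$\mathcal{L}$-$M$-injective; (2) for each $(R,I,f,Q)\in\mathcal{L}$ with $\ker(f)\in\Omega(M)$, the homomorphism $f$ extends to a homomorphism from $R$ to $Q$; (3) for each $(R,I,f,Q)\in\mathcal{L}$ with $\ker(f)\in\Omega(M)$, there exists an element $x\in Q$ such that $f(a)=ax$ for all $a\in I$. Then (2) and (3) are equivalent, and if $M$ satisfies condition $(\mathcal{L})$ then (1) implies (2). Moreover, if $\mathcal{L}$ satisfies conditions $(\alpha)$ and $(\mu)$, then (2) implies (1).
   Context: $R$ is an associative ring with nonzero identity; all modules are unital left $R$-modules; $N\leq M$ means $N$ is a submodule of $M$. $\mathcal{M}$ is the class of all quadruples $(M,N,f,Q)$ with $M,N,Q$ $R$-modules, $N\leq M$ and $f\in\mathrm{Hom}_R(N,Q)$. For a nonempty subclass $\mathcal{L}\subseteq\mathcal{M}$, a module $Q$ is $\mathcal{L}$-$N$-injective if for every $(N,K,f,Q)\in\mathcal{L}$ (with first entry $N$ and last entry $Q$) the homomorphism $f$ extends to a homomorphism from $N$ to $Q$. $Q$ is $s$-$\mathcal{L}$-$M$-injective if $Q$ is $\mathcal{L}$-$N$-injective for all $N\leq M$. For $A\leq B$ and $x\in B$, $(A:x)=\{r\in R\mid rx\in A\}$; $\mathrm{ann}_R(m)=\{r\in R\mid rm=0\}$. $\Omega(M)$ is the set of left ideals $I$ of $R$ such that $\mathrm{ann}_R(m)\subseteq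 I$ for some $m\in M$. Conditions on $\mathcal{L}$: $(\alpha)$: if $(M,N,f,Q)\in\mathcal{L}$, $(M,N',f',Q)\in\mathcal{M}$, $N\subseteq N'$ and $f'|_N=f$, then $(M,N',f',Q)\in\mathcal{L}$. $(\mu)$: if $(M,N,f,Q)\in\mathcal{L}$, then for all $x\in M$, $(R,(N:x),f_x,Q)\in\mathcal{L}$, where $f_x:(N:x)\to Q$ is given by $f_x(r)=f(rx)$. A module $M$ satisfies condition $(\mathcal{L})$ if for every $(B,A,f,Q)\in\mathcal{L}$, $(Rm,(A:x)m,f_{(x,m)},Q)\in\mathcal{L}$ for all $m\in M$ and $x\in B$ with $\mathrm{ann}_R(m)\subseteq(\ker(f):x)$, where $f_{(x,m)}:(A:x)m\to Q$ is the well-defined homomorphism $f_{(x,m)}(rm)=f(rx)$ for $r\in(A:x)$. *)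

theory Defs
  imports "HOL-Algebra.Algebra"
begin

(* The library locale module requires a commutative ring.  The axioms below are the same
   ones over an arbitrary ring; its record type and its predicate submodule, which do not
   mention commutativity, are reused.

   The ring and all modules have their carriers in one type 'a, which plays the role of the
   universe: this lets R itself occur as an entry of a quadruple next to arbitrary modules.
   The mult and one fields of a module record carry no meaning. *)

locale left_module = R?: ring R + M?: abelian_group M
  for R :: "('a, 'c) ring_scheme" (structure) and M :: "('a, 'b) module" (structure) +
  assumes smult_closed [simp, intro]:
      "\<lbrakk>a \<in> carrier R; x \<in> carrier M\<rbrakk> \<Longrightarrow> a \<odot>\<^bsub>M\<^esub> x \<in> carrier M"
    and smult_l_distr:
      "\<lbrakk>a \<in> carrier R; b \<in> carrier R; x \<in> carrier M\<rbrakk> \<Longrightarrow>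
      (a \<oplus> b) \<odot>\<^bsub>M\<^esub> x = a \<odot>\<^bsub>M\<^esub> x \<oplus>\<^bsub>M\<^esub> b \<odot>\<^bsub>M\<^esub> x"
    and smult_r_distr:
      "\<lbrakk>a \<in> carrier R; x \<in> carrier M; y \<in> carrier M\<rbrakk> \<Longrightarrow>
      a \<odot>\<^bsub>M\<^esub> (x \<oplus>\<^bsub>M\<^esub> y) = a \<odot>\<^bsub>M\<^esub> x \<oplus>\<^bsub>M\<^esub> a \<odot>\<^bsub>M\<^esub> y"
    and smult_assoc1:
      "\<lbrakk>a \<in> carrier R; b \<in> carrier R; x \<in> carrier M\<rbrakk> \<Longrightarrow>
      (a \<otimes> b) \<odot>\<^bsub>M\<^esub> x = a \<odot>\<^bsub>M\<^esub> (b \<odot>\<^bsub>M\<^esub> x)"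
    and smult_one [simp]:
      "x \<in> carrier M \<Longrightarrow> \<one> \<odot>\<^bsub>M\<^esub> x = x"

definition regular_module :: "'a ring \<Rightarrow> ('a, 'a) module" where
  "regular_module R = \<lparr>carrier = carrier R, monoid.mult = (\<otimes>\<^bsub>R\<^esub>), monoid.one = \<one>\<^bsub>R\<^esub>,
     ring.zero = \<zero>\<^bsub>R\<^esub>, ring.add = (\<oplus>\<^bsub>R\<^esub>), module.smult = (\<otimes>\<^bsub>R\<^esub>)\<rparr>"

abbreviation sub_mod :: "('a, 'b) module \<Rightarrow> 'b set \<Rightarrow> ('a, 'b) module" where
  "sub_mod M N \<equiv> M\<lparr>carrier := N\<rparr>"

(* Homomorphisms are extensional, so that equality of functions is equality of maps on the
   domain; restrictions below therefore use the library's restrict. *)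

definition lmod_hom :: "'a ring \<Rightarrow> ('a, 'a) module \<Rightarrow> ('a, 'a) module \<Rightarrow> ('a \<Rightarrow> 'a) set" where
  "lmod_hom R M Q = {f \<in> carrier M \<rightarrow>\<^sub>E carrier Q.
     (\<forall>x\<in>carrier M. \<forall>y\<in>carrier M. f (x \<oplus>\<^bsub>M\<^esub> y) = f x \<oplus>\<^bsub>Q\<^esub> f y) \<and>
     (\<forall>r\<in>carrier R. \<forall>x\<in>carrier M. f (r \<odot>\<^bsub>M\<^esub> x) = r \<odot>\<^bsub>Q\<^esub> f x)}"

type_synonym 'a quadruple = "('a, 'a) module \<times> 'a set \<times> ('a \<Rightarrow> 'a) \<times> ('a, 'a) module"

definition all_quadruples :: "'a ring \<Rightarrow> 'a quadruple set" where
  "all_quadruples R = {(M, N, f, Q). left_module R M \<and> left_module R Q \<and>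
     submodule N R M \<and> f \<in> lmod_hom R (sub_mod M N) Q}"

definition extends_to_hom ::
  "'a ring \<Rightarrow> ('a, 'a) module \<Rightarrow> 'a set \<Rightarrow> ('a \<Rightarrow> 'a) \<Rightarrow> ('a, 'a) module \<Rightarrow> bool" where
  "extends_to_hom R M N f Q \<longleftrightarrow> (\<exists>g\<in>lmod_hom R M Q. \<forall>a\<in>N. g a = f a)"

definition L_injective ::
  "'a ring \<Rightarrow> 'a quadruple set \<Rightarrow> ('a, 'a) module \<Rightarrow> ('a, 'a) module \<Rightarrow> bool" where
  "L_injective R L N Q \<longleftrightarrow> (\<forall>K f. (N, K, f, Q) \<in> L \<longrightarrow> extends_to_hom R N K f Q)"

definition s_L_injective ::
  "'a ring \<Rightarrow> 'a quadruple set \<Rightarrow> ('a, 'a) module \<Rightarrow> ('a, 'a) module \<Rightarrow> bool" where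
  "s_L_injective R L M Q \<longleftrightarrow> (\<forall>N. submodule N R M \<longrightarrow> L_injective R L (sub_mod M N) Q)"

definition colon :: "'a ring \<Rightarrow> ('a, 'a) module \<Rightarrow> 'a set \<Rightarrow> 'a \<Rightarrow> 'a set" where
  "colon R B A x = {r \<in> carrier R. r \<odot>\<^bsub>B\<^esub> x \<in> A}"

definition ann :: "'a ring \<Rightarrow> ('a, 'a) module \<Rightarrow> 'a \<Rightarrow> 'a set" where
  "ann R M m = {r \<in> carrier R. r \<odot>\<^bsub>M\<^esub> m = \<zero>\<^bsub>M\<^esub>}"

definition left_ideal :: "'a set \<Rightarrow> 'a ring \<Rightarrow> bool" where
  "left_ideal I R \<longleftrightarrow> submodule I R (regular_module R)"

definition Omega :: "'a ring \<Rightarrow> ('a, 'a) module \<Rightarrow> 'a set set" where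
  "Omega R M = {I. left_ideal I R \<and> (\<exists>m\<in>carrier M. ann R M m \<subseteq> I)}"

(* The kernel of the homomorphism f from the submodule N of M to Q. *)
abbreviation hom_ker ::
  "('a, 'a) module \<Rightarrow> 'a set \<Rightarrow> ('a \<Rightarrow> 'a) \<Rightarrow> ('a, 'a) module \<Rightarrow> 'a set" where
  "hom_ker M N f Q \<equiv> a_kernel (sub_mod M N) Q f"

definition cond_alpha :: "'a ring \<Rightarrow> 'a quadruple set \<Rightarrow> bool" where
  "cond_alpha R L \<longleftrightarrow> (\<forall>M N f Q N' f'.
     (M, N, f, Q) \<in> L \<and> (M, N', f', Q) \<in> all_quadruples R \<and> N \<subseteq> N' \<and> restrict f' N = f
     \<longrightarrow> (M, N', f', Q) \<in> L)"

definition f_at ::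
  "'a ring \<Rightarrow> ('a, 'a) module \<Rightarrow> 'a set \<Rightarrow> ('a \<Rightarrow> 'a) \<Rightarrow> 'a \<Rightarrow> 'a \<Rightarrow> 'a" where
  "f_at R M N f x = (\<lambda>r\<in>colon R M N x. f (r \<odot>\<^bsub>M\<^esub> x))"

definition cond_mu :: "'a ring \<Rightarrow> 'a quadruple set \<Rightarrow> bool" where
  "cond_mu R L \<longleftrightarrow> (\<forall>M N f Q. (M, N, f, Q) \<in> L \<longrightarrow>
     (\<forall>x\<in>carrier M. (regular_module R, colon R M N x, f_at R M N f x, Q) \<in> L))"

definition set_smult :: "('a, 'a) module \<Rightarrow> 'a set \<Rightarrow> 'a \<Rightarrow> 'a set" where
  "set_smult M I m = (\<lambda>r. r \<odot>\<^bsub>M\<^esub> m) ` I"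

(* The map r m |-> f (r x) on (A : x) m; see f_pair_eq for its well-definedness. *)
definition f_pair ::
  "'a ring \<Rightarrow> ('a, 'a) module \<Rightarrow> 'a set \<Rightarrow> ('a \<Rightarrow> 'a) \<Rightarrow> 'a \<Rightarrow> ('a, 'a) module \<Rightarrow> 'a \<Rightarrow> 'a \<Rightarrow> 'a"
  where
  "f_pair R B A f x M m = (\<lambda>y\<in>set_smult M (colon R B A x) m.
     THE q. \<exists>r\<in>colon R B A x. y = r \<odot>\<^bsub>M\<^esub> m \<and> q = f (r \<odot>\<^bsub>B\<^esub> x))"

definition cond_L :: "'a ring \<Rightarrow> 'a quadruple set \<Rightarrow> ('a, 'a) module \<Rightarrow> bool" where
  "cond_L R L M \<longleftrightarrow> (\<forall>B A f Q. (B, A, f, Q) \<in> L \<longrightarrow>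
     (\<forall>m\<in>carrier M. \<forall>x\<in>carrier B. ann R M m \<subseteq> colon R B (hom_ker B A f Q) x \<longrightarrow>
        (sub_mod M (set_smult M (carrier R) m), set_smult M (colon R B A x) m,
         f_pair R B A f x M m, Q) \<in> L))"

definition ext_cond ::
  "'a ring \<Rightarrow> 'a quadruple set \<Rightarrow> ('a, 'a) module \<Rightarrow> ('a, 'a) module \<Rightarrow> bool" where
  "ext_cond R L M Q \<longleftrightarrow> (\<forall>I f. (regular_module R, I, f, Q) \<in> L \<longrightarrow>
     hom_ker (regular_module R) I f Q \<in> Omega R M \<longrightarrow>
     extends_to_hom R (regular_module R) I f Q)"

definition elt_cond ::
  "'a ring \<Rightarrow> 'a quadruple set \<Rightarrow> ('a, 'a) module \<Rightarrow> ('a, 'a) module \<Rightarrow> bool" where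
  "elt_cond R L M Q \<longleftrightarrow> (\<forall>I f. (regular_module R, I, f, Q) \<in> L \<longrightarrow>
     hom_ker (regular_module R) I f Q \<in> Omega R M \<longrightarrow>
     (\<exists>x\<in>carrier Q. \<forall>a\<in>I. f a = a \<odot>\<^bsub>Q\<^esub> x))"

lemma regular_left_module:
  fixes R :: "'a ring"
  assumes "ring R"
  shows "left_module R (regular_module R)"
proof -
  interpret ring R by (rule assms)
  have "abelian_group (regular_module R)"
  proof (rule abelian_groupI)
    fix x assume "x \<in> carrier (regular_module R)"
    then show "\<exists>y\<in>carrier (regular_module R).
        y \<oplus>\<^bsub>regular_module R\<^esub> x = \<zero>\<^bsub>regular_module R\<^esub>"
      by (intro bexI[of _ "\<ominus>\<^bsub>R\<^esub> x"]) (auto simp: regular_module_def l_neg)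
  qed (auto simp: regular_module_def a_assoc intro: a_comm)
  then show ?thesis
    by (intro left_module.intro left_module_axioms.intro ring_axioms)
      (auto simp: regular_module_def l_distr r_distr m_assoc)
qed

(* Well-definedness of f_pair in the situation of cond_L. *)
lemma f_pair_eq:
  assumes M: "left_module R M" and q: "(B, A, f, Q) \<in> all_quadruples R"
    and m: "m \<in> carrier M" and x: "x \<in> carrier B"
    and ann: "ann R M m \<subseteq> colon R B (hom_ker B A f Q) x"
    and r: "r \<in> colon R B A x"
  shows "f_pair R B A f x M m (r \<odot>\<^bsub>M\<^esub> m) = f (r \<odot>\<^bsub>B\<^esub> x)"
proof -
  interpret M: left_module R M by (rule M)
  interpret B: left_module R B using q by (simp add: all_quadruples_def)
  interpret Q: left_module R Q using q by (simp add: all_quadruples_def)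
  have f: "f \<in> lmod_hom R (sub_mod B A) Q" using q by (simp add: all_quadruples_def)
  have eq: "f (s \<odot>\<^bsub>B\<^esub> x) = f (r \<odot>\<^bsub>B\<^esub> x)"
    if s: "s \<in> colon R B A x" and sm: "r \<odot>\<^bsub>M\<^esub> m = s \<odot>\<^bsub>M\<^esub> m" for s
  proof -
    have rc: "r \<in> carrier R" "r \<odot>\<^bsub>B\<^esub> x \<in> A" and sc: "s \<in> carrier R" "s \<odot>\<^bsub>B\<^esub> x \<in> A"
      using r s by (auto simp: colon_def)
    define t where "t = r \<ominus>\<^bsub>R\<^esub> s"
    have t: "t \<in> carrier R" using rc sc by (simp add: t_def)
    have rt: "r = t \<oplus>\<^bsub>R\<^esub> s"
      using rc sc by (simp add: t_def a_minus_def M.R.a_assoc M.R.l_neg)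
    have "t \<odot>\<^bsub>M\<^esub> m \<oplus>\<^bsub>M\<^esub> s \<odot>\<^bsub>M\<^esub> m = s \<odot>\<^bsub>M\<^esub> m"
      using sm rt t sc m by (simp add: M.smult_l_distr)
    then have "t \<odot>\<^bsub>M\<^esub> m = \<zero>\<^bsub>M\<^esub>"
      using t sc m M.M.add.r_cancel_one[of "s \<odot>\<^bsub>M\<^esub> m" "t \<odot>\<^bsub>M\<^esub> m"] by simp
    then have "t \<in> ann R M m" using t by (simp add: ann_def)
    then have tx: "t \<odot>\<^bsub>B\<^esub> x \<in> A" "f (t \<odot>\<^bsub>B\<^esub> x) = \<zero>\<^bsub>Q\<^esub>"
      using ann by (auto simp: colon_def a_kernel_def')
    have "r \<odot>\<^bsub>B\<^esub> x = t \<odot>\<^bsub>B\<^esub> x \<oplus>\<^bsub>B\<^esub> s \<odot>\<^bsub>B\<^esub> x"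
      using rt t sc x by (simp add: B.smult_l_distr)
    then have "f (r \<odot>\<^bsub>B\<^esub> x) = f (t \<odot>\<^bsub>B\<^esub> x) \<oplus>\<^bsub>Q\<^esub> f (s \<odot>\<^bsub>B\<^esub> x)"
      using f tx sc by (simp add: lmod_hom_def)
    moreover have "f (s \<odot>\<^bsub>B\<^esub> x) \<in> carrier Q"
      using f sc by (auto simp: lmod_hom_def)
    ultimately show ?thesis using tx by simp
  qed
  have "(THE q. \<exists>s\<in>colon R B A x. r \<odot>\<^bsub>M\<^esub> m = s \<odot>\<^bsub>M\<^esub> m \<and> q = f (s \<odot>\<^bsub>B\<^esub> x)) = f (r \<odot>\<^bsub>B\<^esub> x)"
  proof (rule the_equality)
    show "\<exists>s\<in>colon R B A x. r \<odot>\<^bsub>M\<^esub> m = s \<odot>\<^bsub>M\<^esub> m \<and> f (r \<odot>\<^bsub>B\<^esub> x) = f (s \<odot>\<^bsub>B\<^esub> x)"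
      using r by blast
  qed (use eq in blast)
  moreover have "r \<odot>\<^bsub>M\<^esub> m \<in> set_smult M (colon R B A x) m"
    using r by (auto simp: set_smult_def)
  ultimately show ?thesis by (simp add: f_pair_def)
qed

end

theory Submission
  imports Defs
begin

text \<open>
  A homomorphism from \<open>R\<close> is multiplication by the image of \<open>1\<close>, which identifies (2) with (3).
  For (1) to (2), if \<open>ann m\<close> lies in the kernel of \<open>f\<close>, condition \<open>(L)\<close> with \<open>x = 1\<close> transports
  \<open>f\<close> to \<open>R m\<close>; an extension \<open>g\<close> of the transported map gives \<open>f a = a (g m)\<close>.
  For (2) to (1), take a maximal extension of \<open>f\<close> inside \<open>N\<close>, viewed through its graph. It remains
  in \<open>L\<close> by \<open>(\<alpha>)\<close>, and for \<open>x\<close> in \<open>N\<close> the map provided by \<open>(\<mu>)\<close> kills \<open>ann x\<close>, so it is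
  multiplication by some \<open>y\<close>. Sending \<open>x\<close> to \<open>y\<close> then extends the map to \<open>x\<close>, as in Baer's criterion.
\<close>

section \<open>Arithmetic and submodules of left modules over an arbitrary ring\<close>

context left_module
begin

lemma smult_l_null: "x \<in> carrier M \<Longrightarrow> \<zero> \<odot>\<^bsub>M\<^esub> x = \<zero>\<^bsub>M\<^esub>"
proof -
  assume x: "x \<in> carrier M"
  have "\<zero> \<odot>\<^bsub>M\<^esub> x \<oplus>\<^bsub>M\<^esub> \<zero> \<odot>\<^bsub>M\<^esub> x = \<zero> \<odot>\<^bsub>M\<^esub> x"
    using smult_l_distr[of \<zero> \<zero> x] x by simp
  then show ?thesis using x M.add.r_cancel_one by (metis R.zero_closed smult_closed)
qed

lemma smult_r_null: "r \<in> carrier R \<Longrightarrow> r \<odot>\<^bsub>M\<^esub> \<zero>\<^bsub>M\<^esub> = \<zero>\<^bsub>M\<^esub>"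
  using smult_assoc1[of r \<zero> "\<zero>\<^bsub>M\<^esub>"] by (simp add: smult_l_null)

lemma smult_minus_one: "x \<in> carrier M \<Longrightarrow> (\<ominus> \<one>) \<odot>\<^bsub>M\<^esub> x = \<ominus>\<^bsub>M\<^esub> x"
  using smult_l_distr[of "\<ominus> \<one>" \<one> x]
  by (intro M.minus_equality[symmetric]) (simp_all add: R.l_neg smult_l_null)

text \<open>Negatives need no separate check: -x = (-1) x, so closure under scalars covers
  them.\<close>

lemma submodule_criterion:
  assumes "N \<subseteq> carrier M" and "\<zero>\<^bsub>M\<^esub> \<in> N"
    and "\<And>x y. \<lbrakk>x \<in> N; y \<in> N\<rbrakk> \<Longrightarrow> x \<oplus>\<^bsub>M\<^esub> y \<in> N"
    and "\<And>r x. \<lbrakk>r \<in> carrier R; x \<in> N\<rbrakk> \<Longrightarrow> r \<odot>\<^bsub>M\<^esub> x \<in> N"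
  shows "submodule N R M"
proof -
  have "\<ominus>\<^bsub>M\<^esub> x \<in> N" if "x \<in> N" for x
    using assms(4)[of "\<ominus> \<one>" x] that assms(1) smult_minus_one[of x] by auto
  with assms show ?thesis
    by unfold_locales (auto simp: a_inv_def)
qed

lemma submodule_props:
  assumes "submodule N R M"
  shows "N \<subseteq> carrier M" and "\<zero>\<^bsub>M\<^esub> \<in> N"
    and "\<And>x y. \<lbrakk>x \<in> N; y \<in> N\<rbrakk> \<Longrightarrow> x \<oplus>\<^bsub>M\<^esub> y \<in> N"
    and "\<And>r x. \<lbrakk>r \<in> carrier R; x \<in> N\<rbrakk> \<Longrightarrow> r \<odot>\<^bsub>M\<^esub> x \<in> N"
proof -
  interpret N: submodule N R M by (rule assms)
  show "N \<subseteq> carrier M" "\<zero>\<^bsub>M\<^esub> \<in> N"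
    "\<And>x y. \<lbrakk>x \<in> N; y \<in> N\<rbrakk> \<Longrightarrow> x \<oplus>\<^bsub>M\<^esub> y \<in> N"
    "\<And>r x. \<lbrakk>r \<in> carrier R; x \<in> N\<rbrakk> \<Longrightarrow> r \<odot>\<^bsub>M\<^esub> x \<in> N"
    using N.subset N.one_closed N.m_closed N.smult_closed by auto
qed

text \<open>Lets a submodule serve as the ambient module of a quadruple, as the quantification over
  all submodules in \<open>s_L_injective\<close> demands.\<close>

lemma left_module_sub_mod:
  assumes "submodule N R M"
  shows "left_module R (M\<lparr>carrier := N\<rparr>)"
proof -
  note N = submodule_props[OF assms]
  have mem: "x \<in> carrier M" if "x \<in> N" for x using that N(1) by blast
  have "abelian_group (M\<lparr>carrier := N\<rparr>)"
  proof (rule abelian_groupI)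
    fix x assume x: "x \<in> carrier (M\<lparr>carrier := N\<rparr>)"
    then have "(\<ominus> \<one>) \<odot>\<^bsub>M\<^esub> x \<in> N" by (simp add: N(4))
    moreover have "(\<ominus> \<one>) \<odot>\<^bsub>M\<^esub> x \<oplus>\<^bsub>M\<^esub> x = \<zero>\<^bsub>M\<^esub>"
      using x mem by (simp add: smult_minus_one M.l_neg)
    ultimately show "\<exists>y\<in>carrier (M\<lparr>carrier := N\<rparr>).
        y \<oplus>\<^bsub>M\<lparr>carrier := N\<rparr>\<^esub> x = \<zero>\<^bsub>M\<lparr>carrier := N\<rparr>\<^esub>" by auto
  qed (use N mem in \<open>auto simp: M.a_assoc intro: M.a_comm\<close>)
  then show ?thesis
    by (intro left_module.intro left_module_axioms.intro R.ring_axioms)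
      (use N mem in \<open>auto simp: smult_l_distr smult_r_distr smult_assoc1\<close>)
qed

end

text \<open>Makes R m one of the submodules to which \<open>s_L_injective\<close> applies; the image
  is \<open>set_smult M (carrier R) m\<close> written out.\<close>

lemma (in left_module) submodule_cyclic:
  assumes "m \<in> carrier M"
  shows "submodule ((\<lambda>r. r \<odot>\<^bsub>M\<^esub> m) ` carrier R) R M"
proof (rule submodule_criterion)
  show "\<zero>\<^bsub>M\<^esub> \<in> (\<lambda>r. r \<odot>\<^bsub>M\<^esub> m) ` carrier R"
    using smult_l_null[OF assms] R.zero_closed by (metis imageI)
next
  fix y z assume "y \<in> (\<lambda>r. r \<odot>\<^bsub>M\<^esub> m) ` carrier R" "z \<in> (\<lambda>r. r \<odot>\<^bsub>M\<^esub> m) ` carrier R"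
  then obtain r s where "r \<in> carrier R" "y = r \<odot>\<^bsub>M\<^esub> m" "s \<in> carrier R" "z = s \<odot>\<^bsub>M\<^esub> m"
    by blast
  then show "y \<oplus>\<^bsub>M\<^esub> z \<in> (\<lambda>r. r \<odot>\<^bsub>M\<^esub> m) ` carrier R"
    using assms by (intro image_eqI[of _ _ "r \<oplus> s"]) (simp_all add: smult_l_distr)
next
  fix r y assume "r \<in> carrier R" "y \<in> (\<lambda>r. r \<odot>\<^bsub>M\<^esub> m) ` carrier R"
  then obtain s where "r \<in> carrier R" "s \<in> carrier R" "y = s \<odot>\<^bsub>M\<^esub> m" by blast
  then show "r \<odot>\<^bsub>M\<^esub> y \<in> (\<lambda>r. r \<odot>\<^bsub>M\<^esub> m) ` carrier R"
    using assms by (intro image_eqI[of _ _ "r \<otimes> s"]) (simp_all add: smult_assoc1)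
qed (use assms in auto)

section \<open>Homomorphisms on submodules and their kernels\<close>

lemma lmod_hom_props:
  assumes "f \<in> lmod_hom R (sub_mod M N) Q"
  shows "f \<in> extensional N" and "\<And>x. x \<in> N \<Longrightarrow> f x \<in> carrier Q"
    and "\<And>x y. \<lbrakk>x \<in> N; y \<in> N\<rbrakk> \<Longrightarrow> f (x \<oplus>\<^bsub>M\<^esub> y) = f x \<oplus>\<^bsub>Q\<^esub> f y"
    and "\<And>r x. \<lbrakk>r \<in> carrier R; x \<in> N\<rbrakk> \<Longrightarrow> f (r \<odot>\<^bsub>M\<^esub> x) = r \<odot>\<^bsub>Q\<^esub> f x"
  using assms by (auto simp: lmod_hom_def PiE_def)

lemma lmod_hom_zero:
  assumes "left_module R M" and "left_module R Q" and "submodule N R M"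
    and "f \<in> lmod_hom R (sub_mod M N) Q"
  shows "f \<zero>\<^bsub>M\<^esub> = \<zero>\<^bsub>Q\<^esub>"
proof -
  interpret M: left_module R M by fact
  interpret Q: left_module R Q by fact
  note N = M.submodule_props[OF assms(3)] and f = lmod_hom_props[OF assms(4)]
  show ?thesis
    using f(4)[of "\<zero>\<^bsub>R\<^esub>" "\<zero>\<^bsub>M\<^esub>"] f(2)[OF N(2)] N(2)
    by (simp add: M.smult_l_null Q.smult_l_null)
qed

text \<open>Over the regular module this says that kernels are left ideals, which membership in
  \<open>Omega\<close> requires besides the annihilator inclusion.\<close>

lemma submodule_hom_ker:
  assumes "left_module R M" and "left_module R Q" and "submodule N R M"
    and "f \<in> lmod_hom R (sub_mod M N) Q"
  shows "submodule (hom_ker M N f Q) R M"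
proof -
  interpret M: left_module R M by fact
  interpret Q: left_module R Q by fact
  note N = M.submodule_props[OF assms(3)] and f = lmod_hom_props[OF assms(4)]
  show ?thesis
    by (rule M.submodule_criterion)
      (use N f lmod_hom_zero[OF assms] in \<open>auto simp: a_kernel_def' Q.smult_r_null\<close>)
qed

section \<open>From injectivity to multiplication by an element\<close>

text \<open>Both conditions range over the same quadruples with the same kernel restriction, so it
  suffices to compare their conclusions one quadruple at a time.\<close>

lemma ext_cond_iff_elt_cond:
  fixes R :: "'a ring"
  assumes R: "ring R" and L: "L \<subseteq> all_quadruples R" and Q: "left_module R Q"
  shows "ext_cond R L M Q \<longleftrightarrow> elt_cond R L M Q"
proof -
  interpret Q: left_module R Q by (rule Q)
  have "extends_to_hom R (regular_module R) I f Q \<longleftrightarrow>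
      (\<exists>x\<in>carrier Q. \<forall>a\<in>I. f a = a \<odot>\<^bsub>Q\<^esub> x)" (is "?ext \<longleftrightarrow> ?elt")
    if "(regular_module R, I, f, Q) \<in> L" for I f
  proof -
    have "submodule I R (regular_module R)"
      using that L by (auto simp: all_quadruples_def)
    then have I: "I \<subseteq> carrier R"
      using left_module.submodule_props(1)[OF regular_left_module[OF R]]
      by (auto simp: regular_module_def)
    show ?thesis
    proof
      assume ?ext
      then obtain g where g: "g \<in> lmod_hom R (regular_module R) Q" "\<And>a. a \<in> I \<Longrightarrow> g a = f a"
        by (auto simp: extends_to_hom_def)
      have gs: "g (r \<otimes>\<^bsub>R\<^esub> x) = r \<odot>\<^bsub>Q\<^esub> g x" if "r \<in> carrier R" "x \<in> carrier R" for r x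
        using g(1) that by (simp add: lmod_hom_def regular_module_def)
      have "f a = a \<odot>\<^bsub>Q\<^esub> g \<one>\<^bsub>R\<^esub>" if "a \<in> I" for a
      proof -
        have "a \<in> carrier R" using that I by blast
        then show ?thesis using g(2)[OF that] gs[of a "\<one>\<^bsub>R\<^esub>"] by simp
      qed
      moreover have "g \<one>\<^bsub>R\<^esub> \<in> carrier Q"
        using g(1) by (auto simp: lmod_hom_def regular_module_def)
      ultimately show ?elt by blast
    next
      assume ?elt
      then obtain x where x: "x \<in> carrier Q" "\<And>a. a \<in> I \<Longrightarrow> f a = a \<odot>\<^bsub>Q\<^esub> x" by blast
      have "(\<lambda>r\<in>carrier R. r \<odot>\<^bsub>Q\<^esub> x) \<in> lmod_hom R (regular_module R) Q"
        using x(1)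
        by (auto simp: lmod_hom_def regular_module_def Q.smult_l_distr Q.smult_assoc1)
      moreover have "(\<lambda>r\<in>carrier R. r \<odot>\<^bsub>Q\<^esub> x) a = f a" if "a \<in> I" for a
        using x(2)[OF that] that I by auto
      ultimately show ?ext unfolding extends_to_hom_def by blast
    qed
  qed
  then show ?thesis unfolding ext_cond_def elt_cond_def by blast
qed

text \<open>The target is (3) rather than (2) because injectivity yields a map on R m only. Its
  value at m is already the required element of Q, whereas an extension to R would still have to be
  built.\<close>

lemma s_L_injective_imp_elt_cond:
  fixes R :: "'a ring"
  assumes R: "ring R" and L: "L \<subseteq> all_quadruples R" and M: "left_module R M"
    and cL: "cond_L R L M" and inj: "s_L_injective R L M Q"
  shows "elt_cond R L M Q"
  unfolding elt_cond_def
proof (intro allI impI)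
  fix I f
  assume q: "(regular_module R, I, f, Q) \<in> L"
    and ker: "hom_ker (regular_module R) I f Q \<in> Omega R M"
  interpret M: left_module R M by (rule M)
  let ?Rm = "\<lambda>m. set_smult M (carrier R) m"
  have q': "(regular_module R, I, f, Q) \<in> all_quadruples R" using q L by blast
  then have I: "I \<subseteq> carrier R"
    using left_module.submodule_props(1)[OF regular_left_module[OF R]]
    by (fastforce simp: all_quadruples_def regular_module_def)
  obtain m where m: "m \<in> carrier M"
    and ann: "ann R M m \<subseteq> hom_ker (regular_module R) I f Q"
    using ker by (auto simp: Omega_def)
  have one: "\<one>\<^bsub>R\<^esub> \<in> carrier (regular_module R)" by (simp add: regular_module_def)
  \<comment> \<open>At x = 1 the colon sets occurring in condition (L) collapse to I and to the
    kernel of f.\<close>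
  have colon_one: "colon R (regular_module R) J \<one>\<^bsub>R\<^esub> = J" if "J \<subseteq> carrier R" for J
    using that by (auto simp: colon_def regular_module_def)
  have "hom_ker (regular_module R) I f Q \<subseteq> carrier R"
    using I by (auto simp: a_kernel_def')
  with ann have ann1:
    "ann R M m \<subseteq> colon R (regular_module R) (hom_ker (regular_module R) I f Q) \<one>\<^bsub>R\<^esub>"
    by (simp add: colon_one)
  let ?h = "f_pair R (regular_module R) I f \<one>\<^bsub>R\<^esub> M m"
  \<comment> \<open>Condition (L) with B = R, A = I and x = 1; \<open>?h\<close> is the map a m |->
    f a on I m.\<close>
  have "(sub_mod M (?Rm m), set_smult M I m, ?h, Q) \<in> L"
    using cL q m one ann1 unfolding cond_L_def by (metis colon_one I)
  moreover have "L_injective R L (sub_mod M (?Rm m)) Q"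
    using inj M.submodule_cyclic[OF m] by (auto simp: s_L_injective_def set_smult_def)
  ultimately obtain g where g: "g \<in> lmod_hom R (sub_mod M (?Rm m)) Q"
    and gh: "\<And>y. y \<in> set_smult M I m \<Longrightarrow> g y = ?h y"
    unfolding L_injective_def extends_to_hom_def by blast
  \<comment> \<open>m need not lie in I m, where \<open>?h\<close> lives, but m = 1 m lies in the
    domain of the extension g. So g m makes sense, and linearity of g gives g (a m) = a (g
    m).\<close>
  have mRm: "m \<in> ?Rm m"
    using m unfolding set_smult_def by (metis M.R.one_closed M.smult_one imageI)
  have "f a = a \<odot>\<^bsub>Q\<^esub> g m" if a: "a \<in> I" for a
  proof -
    have aR: "a \<in> carrier R" using a I by blast
    have "f a = ?h (a \<odot>\<^bsub>M\<^esub> m)"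
      using f_pair_eq[OF M q' m one ann1, of a] a aR I
      by (simp add: colon_one) (simp add: regular_module_def)
    also have "\<dots> = g (a \<odot>\<^bsub>M\<^esub> m)"
      using gh a by (simp add: set_smult_def)
    also have "\<dots> = a \<odot>\<^bsub>Q\<^esub> g m"
      by (rule lmod_hom_props(4)[OF g aR mRm])
    finally show ?thesis .
  qed
  with lmod_hom_props(2)[OF g mRm] show "\<exists>x\<in>carrier Q. \<forall>a\<in>I. f a = a \<odot>\<^bsub>Q\<^esub> x" by blast
qed

section \<open>Graphs of partial homomorphisms: chains, maximal elements, adjoining a point\<close>

text \<open>Partial homomorphisms are encoded by their graphs, so that extension is inclusion and
  Zorn's lemma for set inclusion applies.\<close>

definition hom_graph :: "'a ring \<Rightarrow> ('a, 'a) module \<Rightarrow> ('a, 'a) module \<Rightarrow> ('a \<times> 'a) set \<Rightarrow> bool"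
  where
  "hom_graph R M Q G \<longleftrightarrow> G \<subseteq> carrier M \<times> carrier Q \<and> single_valued G \<and>
     (\<zero>\<^bsub>M\<^esub>, \<zero>\<^bsub>Q\<^esub>) \<in> G \<and>
     (\<forall>(x, u)\<in>G. \<forall>(y, v)\<in>G. (x \<oplus>\<^bsub>M\<^esub> y, u \<oplus>\<^bsub>Q\<^esub> v) \<in> G) \<and>
     (\<forall>r\<in>carrier R. \<forall>(x, u)\<in>G. (r \<odot>\<^bsub>M\<^esub> x, r \<odot>\<^bsub>Q\<^esub> u) \<in> G)"

lemma hom_graphI:
  assumes "\<And>x u. (x, u) \<in> G \<Longrightarrow> x \<in> carrier M \<and> u \<in> carrier Q"
    and "single_valued G" and "(\<zero>\<^bsub>M\<^esub>, \<zero>\<^bsub>Q\<^esub>) \<in> G"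
    and "\<And>x u y v. \<lbrakk>(x, u) \<in> G; (y, v) \<in> G\<rbrakk> \<Longrightarrow> (x \<oplus>\<^bsub>M\<^esub> y, u \<oplus>\<^bsub>Q\<^esub> v) \<in> G"
    and "\<And>r x u. \<lbrakk>r \<in> carrier R; (x, u) \<in> G\<rbrakk> \<Longrightarrow> (r \<odot>\<^bsub>M\<^esub> x, r \<odot>\<^bsub>Q\<^esub> u) \<in> G"
  shows "hom_graph R M Q G"
  using assms by (auto simp: hom_graph_def)

lemma hom_graphD:
  assumes "hom_graph R M Q G"
  shows "\<And>x u. (x, u) \<in> G \<Longrightarrow> x \<in> carrier M" and "\<And>x u. (x, u) \<in> G \<Longrightarrow> u \<in> carrier Q"
    and "\<And>x u v. \<lbrakk>(x, u) \<in> G; (x, v) \<in> G\<rbrakk> \<Longrightarrow> u = v" and "(\<zero>\<^bsub>M\<^esub>, \<zero>\<^bsub>Q\<^esub>) \<in> G"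
    and "\<And>x u y v. \<lbrakk>(x, u) \<in> G; (y, v) \<in> G\<rbrakk> \<Longrightarrow> (x \<oplus>\<^bsub>M\<^esub> y, u \<oplus>\<^bsub>Q\<^esub> v) \<in> G"
    and "\<And>r x u. \<lbrakk>r \<in> carrier R; (x, u) \<in> G\<rbrakk> \<Longrightarrow> (r \<odot>\<^bsub>M\<^esub> x, r \<odot>\<^bsub>Q\<^esub> u) \<in> G"
  using assms by (auto simp: hom_graph_def single_valued_def)

lemma hom_graph_of_hom:
  assumes "left_module R M" and "left_module R Q" and "submodule N R M"
    and "f \<in> lmod_hom R (sub_mod M N) Q"
  shows "hom_graph R M Q ((\<lambda>x. (x, f x)) ` N)"
proof -
  interpret M: left_module R M by fact
  note N = M.submodule_props[OF assms(3)] and f = lmod_hom_props[OF assms(4)]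
  show ?thesis
    by (rule hom_graphI)
      (use N f lmod_hom_zero[OF assms] in \<open>auto simp: single_valued_def image_iff\<close>)
qed

text \<open>The way back from graphs to maps: single-valuedness makes the chosen value unique, and
  restricting to \<open>Domain G\<close> provides the extensionality built into
  \<open>lmod_hom\<close>.\<close>

lemma hom_of_hom_graph:
  assumes "left_module R M" and G: "hom_graph R M Q G"
  obtains f where "submodule (Domain G) R M" and "f \<in> lmod_hom R (sub_mod M (Domain G)) Q"
    and "\<And>x u. (x, u) \<in> G \<Longrightarrow> f x = u"
proof -
  interpret M: left_module R M by fact
  define f where "f = (\<lambda>x\<in>Domain G. THE u. (x, u) \<in> G)"
  note sub = hom_graphD(1,2)[OF G] and zero = hom_graphD(4)[OF G]
    and add = hom_graphD(5)[OF G] and smult = hom_graphD(6)[OF G]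
  have f: "f x = u" if "(x, u) \<in> G" for x u
    using that hom_graphD(3)[OF G] by (auto simp: f_def intro!: the_equality)
  have "submodule (Domain G) R M"
    by (rule M.submodule_criterion) (use sub zero add smult in blast)+
  moreover have "f \<in> lmod_hom R (sub_mod M (Domain G)) Q"
  proof -
    have "f x \<in> carrier Q" if "x \<in> Domain G" for x
      using that f sub(2) by (metis DomainE)
    moreover have "f (x \<oplus>\<^bsub>M\<^esub> y) = f x \<oplus>\<^bsub>Q\<^esub> f y" if "x \<in> Domain G" "y \<in> Domain G" for x y
      using that f add by (metis DomainE)
    moreover have "f (r \<odot>\<^bsub>M\<^esub> x) = r \<odot>\<^bsub>Q\<^esub> f x" if "r \<in> carrier R" "x \<in> Domain G" for r x
      using that f smult by (metis DomainE)
    moreover have "f \<in> extensional (Domain G)" by (simp add: f_def)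
    ultimately show ?thesis by (simp add: lmod_hom_def PiE_def Pi_def)
  qed
  ultimately show thesis using f that by blast
qed

text \<open>Each clause of \<open>hom_graph\<close> involves at most two pairs, and two pairs from
  the union of a chain lie in a common member. Nonemptiness of C provides the pair of zeros.\<close>

lemma hom_graph_Union:
  assumes "C \<noteq> {}" and "subset.chain {G. hom_graph R M Q G} C"
  shows "hom_graph R M Q (\<Union>C)"
proof -
  have G: "hom_graph R M Q G" if "G \<in> C" for G
    using that assms(2) by (auto simp: subset.chain_def)
  have two: "\<exists>G\<in>C. p \<in> G \<and> q \<in> G" if "p \<in> \<Union>C" "q \<in> \<Union>C" for p q
    using that assms(2) unfolding subset_chain_def by blast
  show ?thesis
  proof (rule hom_graphI)
    show "(\<zero>\<^bsub>M\<^esub>, \<zero>\<^bsub>Q\<^esub>) \<in> \<Union>C" using hom_graphD(4)[OF G] assms(1) by blast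
    show "single_valued (\<Union>C)"
    proof (rule single_valuedI)
      fix x u v assume "(x, u) \<in> \<Union>C" "(x, v) \<in> \<Union>C"
      from two[OF this] show "u = v" using hom_graphD(3)[OF G] by blast
    qed
  next
    fix x u y v assume "(x, u) \<in> \<Union>C" "(y, v) \<in> \<Union>C"
    from two[OF this] show "(x \<oplus>\<^bsub>M\<^esub> y, u \<oplus>\<^bsub>Q\<^esub> v) \<in> \<Union>C" using hom_graphD(5)[OF G] by blast
  qed (use hom_graphD(1,2,6)[OF G] in blast)+
qed

text \<open>Zorn's lemma is applied to the graphs above \<open>G0\<close>. The result is maximal
  among all graphs, since anything containing G also contains \<open>G0\<close>.\<close>

lemma hom_graph_maximal_extension:
  assumes "hom_graph R M Q G0"
  obtains G where "hom_graph R M Q G" and "G0 \<subseteq> G"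
    and "\<And>H. \<lbrakk>hom_graph R M Q H; G \<subseteq> H\<rbrakk> \<Longrightarrow> H = G"
proof -
  let ?A = "{G. hom_graph R M Q G \<and> G0 \<subseteq> G}"
  have "\<exists>G\<in>?A. \<forall>H\<in>?A. G \<subseteq> H \<longrightarrow> H = G"
  proof (rule subset_Zorn_nonempty)
    show "?A \<noteq> {}" using assms by blast
    fix C assume C: "C \<noteq> {}" "subset.chain ?A C"
    then have "subset.chain {G. hom_graph R M Q G} C" by (auto simp: subset_chain_def)
    then have "hom_graph R M Q (\<Union>C)" by (rule hom_graph_Union[OF C(1)])
    moreover have "G0 \<subseteq> \<Union>C" using C unfolding subset_chain_def by blast
    ultimately show "\<Union>C \<in> ?A" by blast
  qed
  then obtain G where G: "G \<in> ?A" and max: "\<forall>H\<in>?A. G \<subseteq> H \<longrightarrow> H = G" by (rule bexE)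
  show thesis
  proof (rule that)
    show "hom_graph R M Q G" "G0 \<subseteq> G" using G by simp_all
    show "H = G" if "hom_graph R M Q H" "G \<subseteq> H" for H
      using max[rule_format, of H] that \<open>G0 \<subseteq> G\<close> by simp
  qed
qed

text \<open>The hypothesis \<open>compat\<close> says that G agrees with r x |-> r y wherever r x is
  already in its domain; this is exactly what makes the two maps glue.\<close>

lemma hom_graph_adjoin:
  assumes "left_module R M" and "left_module R Q" and G: "hom_graph R M Q G"
    and x: "x \<in> carrier M" and y: "y \<in> carrier Q"
    and compat: "\<And>r u. \<lbrakk>r \<in> carrier R; (r \<odot>\<^bsub>M\<^esub> x, u) \<in> G\<rbrakk> \<Longrightarrow> u = r \<odot>\<^bsub>Q\<^esub> y"
  obtains H where "hom_graph R M Q H" and "G \<subseteq> H" and "(x, y) \<in> H"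
proof
  interpret M: left_module R M by fact
  interpret Q: left_module R Q by fact
  \<comment> \<open>The sum, inside the product of M and Q, of G and the cyclic submodule generated
    by (x, y). Taking r = 0 recovers G, and the pair of zeros with r = 1 gives (x, y).\<close>
  let ?H = "{(k \<oplus>\<^bsub>M\<^esub> r \<odot>\<^bsub>M\<^esub> x, q \<oplus>\<^bsub>Q\<^esub> r \<odot>\<^bsub>Q\<^esub> y) | k q r. (k, q) \<in> G \<and> r \<in> carrier R}"
  note sub = hom_graphD(1,2)[OF G] and zero = hom_graphD(4)[OF G]
    and add = hom_graphD(5)[OF G] and smult = hom_graphD(6)[OF G]
  have HI: "(a, b) \<in> ?H"
    if "(k, q) \<in> G" "r \<in> carrier R" "a = k \<oplus>\<^bsub>M\<^esub> r \<odot>\<^bsub>M\<^esub> x" "b = q \<oplus>\<^bsub>Q\<^esub> r \<odot>\<^bsub>Q\<^esub> y" for k q r a b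
    using that by blast
  show "G \<subseteq> ?H"
  proof
    fix p assume p: "p \<in> G"
    obtain k q where pkq: "p = (k, q)" by fastforce
    show "p \<in> ?H" unfolding pkq
      by (rule HI[of k q "\<zero>\<^bsub>R\<^esub>"])
        (use p pkq sub[of k q] x y in \<open>auto simp: M.smult_l_null Q.smult_l_null\<close>)
  qed
  show "(x, y) \<in> ?H"
    by (rule HI[OF zero, of "\<one>\<^bsub>R\<^esub>"]) (use x y in auto)
  show "hom_graph R M Q ?H"
  proof (rule hom_graphI)
    show "a \<in> carrier M \<and> b \<in> carrier Q" if "(a, b) \<in> ?H" for a b
      using that sub x y by auto
    show "(\<zero>\<^bsub>M\<^esub>, \<zero>\<^bsub>Q\<^esub>) \<in> ?H" using \<open>G \<subseteq> ?H\<close> zero by blast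
    show "single_valued ?H"
    proof (rule single_valuedI)
      fix a b c assume "(a, b) \<in> ?H" "(a, c) \<in> ?H"
      then obtain k q r l p s where
        kq: "(k, q) \<in> G" "r \<in> carrier R" "a = k \<oplus>\<^bsub>M\<^esub> r \<odot>\<^bsub>M\<^esub> x" "b = q \<oplus>\<^bsub>Q\<^esub> r \<odot>\<^bsub>Q\<^esub> y" and
        lp: "(l, p) \<in> G" "s \<in> carrier R" "a = l \<oplus>\<^bsub>M\<^esub> s \<odot>\<^bsub>M\<^esub> x" "c = p \<oplus>\<^bsub>Q\<^esub> s \<odot>\<^bsub>Q\<^esub> y"
        by blast
      \<comment> \<open>Comparing the two representations of a gives t x = l - k, a point in the
        domain of G with value p - q. Then \<open>compat\<close> forces p - q = t y, whence b =
        c.\<close>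
      define t where "t = r \<ominus>\<^bsub>R\<^esub> s"
      have t: "t \<in> carrier R" and r: "r = t \<oplus>\<^bsub>R\<^esub> s"
        using kq lp by (auto simp: t_def a_minus_def M.R.a_assoc M.R.l_neg)
      note c = sub[OF kq(1)] sub[OF lp(1)] t lp(2) x y
      have "(k \<oplus>\<^bsub>M\<^esub> t \<odot>\<^bsub>M\<^esub> x) \<oplus>\<^bsub>M\<^esub> s \<odot>\<^bsub>M\<^esub> x = l \<oplus>\<^bsub>M\<^esub> s \<odot>\<^bsub>M\<^esub> x"
        using kq(3) lp(3) r c by (simp add: M.smult_l_distr M.M.a_assoc)
      then have l: "k \<oplus>\<^bsub>M\<^esub> t \<odot>\<^bsub>M\<^esub> x = l"
        using c by (simp add: M.M.add.r_cancel)
      \<comment> \<open>Subtraction is written through the scalar -1, so that the closure of G under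
        sums and scalars applies.\<close>
      let ?n = "\<ominus>\<^bsub>R\<^esub> \<one>\<^bsub>R\<^esub>"
      have "t \<odot>\<^bsub>M\<^esub> x = l \<oplus>\<^bsub>M\<^esub> ?n \<odot>\<^bsub>M\<^esub> k"
        using l c by (auto simp: M.smult_minus_one M.M.a_ac M.M.r_neg1 M.M.r_neg2)
      moreover have "(l \<oplus>\<^bsub>M\<^esub> ?n \<odot>\<^bsub>M\<^esub> k, p \<oplus>\<^bsub>Q\<^esub> ?n \<odot>\<^bsub>Q\<^esub> q) \<in> G"
        using add[OF lp(1) smult[OF _ kq(1)]] by simp
      ultimately have "p \<oplus>\<^bsub>Q\<^esub> ?n \<odot>\<^bsub>Q\<^esub> q = t \<odot>\<^bsub>Q\<^esub> y"
        using compat t by simp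
      then have "q \<oplus>\<^bsub>Q\<^esub> t \<odot>\<^bsub>Q\<^esub> y = q \<oplus>\<^bsub>Q\<^esub> (p \<oplus>\<^bsub>Q\<^esub> \<ominus>\<^bsub>Q\<^esub> q)"
        using c by (simp add: Q.smult_minus_one)
      also have "\<dots> = p" using c by (simp add: Q.M.a_lcomm Q.M.r_neg)
      finally show "b = c"
        using kq(4) lp(4) r c by (simp add: Q.smult_l_distr flip: Q.M.a_assoc)
    qed
  next
    fix a b a' b' assume H: "(a, b) \<in> ?H" "(a', b') \<in> ?H"
    obtain k q r l p s where
      kq: "(k, q) \<in> G" "r \<in> carrier R" "a = k \<oplus>\<^bsub>M\<^esub> r \<odot>\<^bsub>M\<^esub> x" "b = q \<oplus>\<^bsub>Q\<^esub> r \<odot>\<^bsub>Q\<^esub> y" and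
      lp: "(l, p) \<in> G" "s \<in> carrier R" "a' = l \<oplus>\<^bsub>M\<^esub> s \<odot>\<^bsub>M\<^esub> x" "b' = p \<oplus>\<^bsub>Q\<^esub> s \<odot>\<^bsub>Q\<^esub> y"
      using H by blast
    show "(a \<oplus>\<^bsub>M\<^esub> a', b \<oplus>\<^bsub>Q\<^esub> b') \<in> ?H"
      by (rule HI[OF add[OF kq(1) lp(1)], of "r \<oplus>\<^bsub>R\<^esub> s"])
        (use kq lp sub[OF kq(1)] sub[OF lp(1)] x y
          in \<open>auto simp: M.smult_l_distr Q.smult_l_distr M.M.a_ac Q.M.a_ac\<close>)
  next
    fix r a b assume r: "r \<in> carrier R" and H: "(a, b) \<in> ?H"
    obtain k q s where
      kq: "(k, q) \<in> G" "s \<in> carrier R" "a = k \<oplus>\<^bsub>M\<^esub> s \<odot>\<^bsub>M\<^esub> x" "b = q \<oplus>\<^bsub>Q\<^esub> s \<odot>\<^bsub>Q\<^esub> y"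
      using H by blast
    show "(r \<odot>\<^bsub>M\<^esub> a, r \<odot>\<^bsub>Q\<^esub> b) \<in> ?H"
      by (rule HI[OF smult[OF r kq(1)], of "r \<otimes>\<^bsub>R\<^esub> s"])
        (use kq r sub[OF kq(1)] x y
          in \<open>auto simp: M.smult_r_distr Q.smult_r_distr M.smult_assoc1 Q.smult_assoc1\<close>)
  qed
qed

section \<open>Baer's argument\<close>

text \<open>If r x = 0, then r lies in (N : x) because 0 is in N, and r is sent to f 0 = 0. This
  brings the maps supplied by condition (\<mu>) within the scope of (3).\<close>

lemma ann_subset_hom_ker_f_at:
  assumes "left_module R M" and "left_module R Q" and "submodule N R M"
    and "f \<in> lmod_hom R (sub_mod M N) Q"
  shows "ann R M x \<subseteq> hom_ker (regular_module R) (colon R M N x) (f_at R M N f x) Q"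
proof -
  interpret M: left_module R M by fact
  show ?thesis
    using lmod_hom_zero[OF assms] M.submodule_props(2)[OF assms(3)]
    by (auto simp: ann_def a_kernel_def' f_at_def colon_def)
qed

text \<open>Everything happens inside the fixed ambient module N. A maximal extension is shown to be
  total by adjoining an arbitrary x of N to its graph.\<close>

lemma elt_cond_imp_s_L_injective:
  fixes R :: "'a ring"
  assumes R: "ring R" and L: "L \<subseteq> all_quadruples R"
    and M: "left_module R M" and Q: "left_module R Q"
    and alpha: "cond_alpha R L" and mu: "cond_mu R L" and elt: "elt_cond R L M Q"
  shows "s_L_injective R L M Q"
  unfolding s_L_injective_def L_injective_def
proof (intro allI impI)
  fix N K f
  assume N: "submodule N R M" and q: "(sub_mod M N, K, f, Q) \<in> L"
  interpret M: left_module R M by (rule M)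
  let ?N = "sub_mod M N"
  have N': "left_module R ?N" by (rule M.left_module_sub_mod[OF N])
  have K: "submodule K R ?N" and f: "f \<in> lmod_hom R (sub_mod ?N K) Q"
    using q L by (auto simp: all_quadruples_def)
  let ?G0 = "(\<lambda>x. (x, f x)) ` K"
  obtain G where G: "hom_graph R ?N Q G" and G0: "?G0 \<subseteq> G"
    and max: "\<And>H. \<lbrakk>hom_graph R ?N Q H; G \<subseteq> H\<rbrakk> \<Longrightarrow> H = G"
    using hom_graph_maximal_extension[OF hom_graph_of_hom[OF N' Q K f]] by blast
  obtain g where D: "submodule (Domain G) R ?N"
    and g: "g \<in> lmod_hom R (sub_mod ?N (Domain G)) Q"
    and gG: "\<And>x u. (x, u) \<in> G \<Longrightarrow> g x = u"
    using hom_of_hom_graph[OF N' G] by blast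
  have KD: "K \<subseteq> Domain G" using G0 by auto
  have gf: "g a = f a" if "a \<in> K" for a using that G0 gG by auto
  \<comment> \<open>Condition (\<alpha>) asks for equality of functions and not just agreement on K;
    off K it holds because f is extensional.\<close>
  have "restrict g K = f"
    using gf lmod_hom_props(1)[OF f] by (auto simp: extensional_def restrict_def)
  moreover have "(?N, Domain G, g, Q) \<in> all_quadruples R"
    using N' Q D g by (simp add: all_quadruples_def)
  ultimately have qg: "(?N, Domain G, g, Q) \<in> L"
    using alpha q KD unfolding cond_alpha_def by blast
  have "x \<in> Domain G" if xN: "x \<in> N" for x
  proof -
    \<comment> \<open>\<open>?I\<close> consists of the scalars moving x into the current domain,
      and \<open>?h\<close> records the values already prescribed there.\<close>
    let ?I = "colon R ?N (Domain G) x" and ?h = "f_at R ?N (Domain G) g x"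
    have xM: "x \<in> carrier M" using xN M.submodule_props(1)[OF N] by blast
    have qx: "(regular_module R, ?I, ?h, Q) \<in> L"
      using mu qg xN unfolding cond_mu_def by simp
    then have "submodule (hom_ker (regular_module R) ?I ?h Q) R (regular_module R)"
      using L by (intro submodule_hom_ker) (auto simp: all_quadruples_def)
    \<comment> \<open>Passing to a submodule changes only the carrier, so the annihilator of x is
      the same in N and in M, and x itself witnesses membership in \<open>Omega R M\<close>.\<close>
    moreover have "ann R M x \<subseteq> hom_ker (regular_module R) ?I ?h Q"
      using ann_subset_hom_ker_f_at[OF N' Q D g, of x] by (simp add: ann_def)
    ultimately have "hom_ker (regular_module R) ?I ?h Q \<in> Omega R M"
      using xM by (auto simp: Omega_def left_ideal_def)
    then obtain y where y: "y \<in> carrier Q" and hy: "\<And>a. a \<in> ?I \<Longrightarrow> ?h a = a \<odot>\<^bsub>Q\<^esub> y"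
      using elt qx unfolding elt_cond_def by blast
    \<comment> \<open>The compatibility needed to adjoin (x, y); by maximality the enlarged graph is
      G itself, so x was in its domain.\<close>
    have "u = r \<odot>\<^bsub>Q\<^esub> y" if r: "r \<in> carrier R" and ru: "(r \<odot>\<^bsub>?N\<^esub> x, u) \<in> G" for r u
    proof -
      have "r \<in> ?I" using r ru by (auto simp: colon_def)
      then show ?thesis using hy[of r] gG[OF ru] by (simp add: f_at_def)
    qed
    then obtain H where "hom_graph R ?N Q H" "G \<subseteq> H" "(x, y) \<in> H"
      using hom_graph_adjoin[OF N' Q G _ y, of x] xN by auto
    then show ?thesis using max by blast
  qed
  moreover have "Domain G \<subseteq> N" using G by (auto simp: hom_graph_def)
  ultimately have "Domain G = N" by blast
  with g gf show "extends_to_hom R ?N K f Q"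
    by (auto simp: extends_to_hom_def)
qed

text \<open>Since (2) and (3) are equivalent, both implications between (1) and (2) follow from the
  ones proved for (3).\<close>

theorem proposition3p7:
  fixes R :: "'a ring" and L :: "'a quadruple set" and M Q :: "('a, 'a) module"
  assumes "ring R" and "\<one>\<^bsub>R\<^esub> \<noteq> \<zero>\<^bsub>R\<^esub>"
    and "L \<noteq> {}" and "L \<subseteq> all_quadruples R"
    and "left_module R M" and "left_module R Q"
  shows "(ext_cond R L M Q \<longleftrightarrow> elt_cond R L M Q) \<and>
    (cond_L R L M \<longrightarrow> s_L_injective R L M Q \<longrightarrow> ext_cond R L M Q) \<and>
    (cond_alpha R L \<and> cond_mu R L \<longrightarrow> ext_cond R L M Q \<longrightarrow> s_L_injective R L M Q)"
  using ext_cond_iff_elt_cond[OF assms(1,4,6)] s_L_injective_imp_elt_cond[OF assms(1,4,5)]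
    elt_cond_imp_s_L_injective[OF assms(1,4,5,6)] by blast

end
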